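(* For every $\alpha\in[0,\infty]$, the level set $\{x\in(0,1):\lambda(x)=\alpha\}$ is uncountable and dense in $(0,1)$, where $\lambda(x)$ denotes the exponent of convergence of the sequence of Engel digits of $x$.
   Context: Engel series: let $T:[0,1)\to[0,1)$ be defined by $T(0)=0$ and $T(x)=x\lceil 1/x\rceil-1$ for $x\in(0,1)$, where $\lceil y\rceil$ is the least integer not less than $y$. For $x\in(0,1)$ put $d_1(x)=\lceil 1/x\rceil$ and $d_{n+1}(x)=d_1(T^n(x))$ for $n\ge1$, as long as $T^n(x)\neq0$; these positive integers are the digits of the Engel expansion $x=\frac1{d_1(x)}+\frac1{d_1(x)d_2(x)}+\cdots$. If $T^k(x)=0$ for some $k$, the digit sequence is finite (this happens exactly when $x$ is rational); otherwise it is infinite. Exponent of convergence: for $x\in(0,1)$, $\lambda(x)=\inf\{s\ge0:\sum_{n\ge1}d_n(x)^{-s}<\infty\}\in[0,\infty]$, the sum being over all digits of $x$ and $\inf\emptyset=\infty$. In particular $\lambda(x)=0$ if $x$ is rational. *)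

theory Defs
  imports "HOL-Analysis.Analysis"
begin

text \<open>
  The Engel map, used only on the interval from 0 (included) to 1 (excluded), which it
  maps to itself.  The case distinction is needed because \<^term>\<open>1 / (0::real) = 0\<close>.
\<close>

definition engel_map :: "real \<Rightarrow> real" where
  "engel_map x = (if x = 0 then 0 else x * of_int \<lceil>1 / x\<rceil> - 1)"

text \<open>
  Digits are numbered from 1.  The value of \<open>engel_digit n x\<close> is a digit of \<open>x\<close> only for
  the \<open>n\<close> in \<open>engel_indices x\<close>; this set is finite if the orbit of \<open>x\<close> reaches 0.
\<close>

definition engel_digit :: "nat \<Rightarrow> real \<Rightarrow> int" where
  "engel_digit n x = \<lceil>1 / (engel_map ^^ (n - 1)) x\<rceil>"

definition engel_indices :: "real \<Rightarrow> nat set" where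
  "engel_indices x = {n. 1 \<le> n \<and> (engel_map ^^ (n - 1)) x \<noteq> 0}"

text \<open>
  The infimum is taken in the extended reals, where \<^term>\<open>Inf {} = (\<infinity>::ereal)\<close>.  The digits
  are positive, so summability of the nonnegative terms means that the series is finite.
\<close>

definition engel_exponent :: "real \<Rightarrow> ereal" where
  "engel_exponent x = Inf (ereal ` {s. 0 \<le> s \<and>
     (\<lambda>n. real_of_int (engel_digit n x) powr (- s)) summable_on engel_indices x})"

end

theory Submission
  imports Defs "HOL-Real_Asymp.Real_Asymp"
begin

text \<open>
  For a real sequence \<open>g\<close> increasing to infinity, the numbers with Engel digits
  \<open>\<lceil>c * g n\<rceil>\<close>, one for each large real \<open>c\<close>, all have the exponent of convergence of \<open>g\<close>, and
  they are pairwise distinct because \<open>c\<close> is the limit of \<open>\<lceil>c * g n\<rceil> / g n\<close>.  Taking for \<open>g\<close>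
  an exponential, a power or the logarithm gives every exponent, with points arbitrarily
  close to 0.  The exponent does not change under the Engel map, hence the level sets are mapped
  into themselves by its inverse branches \<open>t \<mapsto> (1 + t) / d\<close>.  These contract distances by the
  factor \<open>1 / d \<le> 1 / 2\<close>, so that pulling back small points of a level set approximates every
  number in the unit interval.
\<close>

subsection \<open>Invariance of the exponent\<close>

text \<open>Renumbers the digits from 0, so that the index of a digit is the number of iterations of
  \<open>engel_map\<close>.\<close>

lemma summable_on_engel_indices_iff:
  "(\<lambda>n. real_of_int (engel_digit n x) powr (- s)) summable_on engel_indices x \<longleftrightarrow>
   (\<lambda>n. real_of_int \<lceil>1 / (engel_map ^^ n) x\<rceil> powr (- s))
     summable_on {n. (engel_map ^^ n) x \<noteq> 0}"
proof -
  have "engel_indices x = Suc ` {n. (engel_map ^^ n) x \<noteq> 0}"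
  proof (intro equalityI subsetI)
    fix n assume "n \<in> engel_indices x"
    then show "n \<in> Suc ` {n. (engel_map ^^ n) x \<noteq> 0}"
      by (cases n) (auto simp: engel_indices_def)
  qed (auto simp: engel_indices_def simp del: funpow.simps)
  then show ?thesis
    by (simp add: summable_on_reindex o_def engel_digit_def)
qed

text \<open>One application of the map deletes the first digit, and a single term does not affect
  summability.\<close>

lemma engel_exponent_engel_map:
  assumes "x \<noteq> 0"
  shows "engel_exponent (engel_map x) = engel_exponent x"
proof -
  have "{n. (engel_map ^^ n) x \<noteq> 0} = insert 0 (Suc ` {n. (engel_map ^^ n) (engel_map x) \<noteq> 0})"
    (is "?A = insert 0 (Suc ` ?B)")
  proof (intro equalityI subsetI)
    fix n assume "n \<in> ?A"
    then show "n \<in> insert 0 (Suc ` ?B)"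
      by (cases n) (auto simp: funpow_swap1)
  qed (use assms in \<open>auto simp: funpow_swap1\<close>)
  then have "(\<lambda>n. real_of_int \<lceil>1 / (engel_map ^^ n) x\<rceil> powr (- s)) summable_on ?A \<longleftrightarrow>
    (\<lambda>n. real_of_int \<lceil>1 / (engel_map ^^ n) (engel_map x)\<rceil> powr (- s)) summable_on ?B" for s
    by (simp add: summable_on_insert_iff summable_on_reindex o_def funpow_swap1)
  then show ?thesis
    by (simp add: engel_exponent_def summable_on_engel_indices_iff)
qed

text \<open>The upper bound on \<open>t\<close> is exactly what places \<open>d / (1 + t)\<close>
  above \<open>d - 1\<close>; positivity of \<open>t\<close> keeps it below
  \<open>d\<close>.\<close>

lemma engel_map_branch:
  fixes d :: int and t :: real
  assumes "2 \<le> d" "0 < t" "t < 1 / (of_int d - 1)"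
  shows "\<lceil>1 / ((1 + t) / of_int d)\<rceil> = d" "engel_map ((1 + t) / of_int d) = t"
proof -
  have d: "real_of_int d \<ge> 2" using assms(1) by simp
  have "t * (real_of_int d - 1) < 1"
    using assms d by (simp add: pos_less_divide_eq)
  then have "real_of_int d - 1 < real_of_int d / (1 + t)"
    using assms d by (simp add: field_simps)
  moreover have "real_of_int d / (1 + t) \<le> real_of_int d"
    using assms d by (simp add: divide_simps)
  ultimately show *: "\<lceil>1 / ((1 + t) / of_int d)\<rceil> = d"
    by (intro ceiling_unique) auto
  show "engel_map ((1 + t) / of_int d) = t"
    unfolding engel_map_def * using assms d by auto
qed

subsection \<open>Density\<close>

lemma engel_level_set_dense:
  assumes small: "\<And>e. 0 < e \<Longrightarrow> \<exists>x. 0 < x \<and> x < e \<and> engel_exponent x = \<alpha>"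
  shows "{0<..<1} \<subseteq> closure {x \<in> {0<..<1}. engel_exponent x = \<alpha>}"
proof
  \<comment> \<open>The approximation is strictly from below because for
    \<open>y = 1 / (d - 1)\<close> one gets \<open>t = y\<close>, which just misses the range
    required by \<open>engel_map_branch\<close>, while every \<open>x < t\<close> satisfies
    it.\<close>
  have approx: "\<exists>x. 0 < x \<and> x < y \<and> y - x \<le> (1/2) ^ n \<and> engel_exponent x = \<alpha>"
    if "0 < y" "y < 1" for y n
    using that
  proof (induction n arbitrary: y)
    case 0
    obtain x where "0 < x" "x < y" "engel_exponent x = \<alpha>"
      using small[OF \<open>0 < y\<close>] by blast
    with 0 show ?case by (intro exI[of _ x]) auto
  next
    case (Suc n)
    \<comment> \<open>Not the Engel digit \<open>\<lceil>1 / y\<rceil>\<close>: for \<open>y = 1 / k\<close> this choice keeps \<open>y * d - 1\<close> positive.\<close>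
    define d where "d = \<lfloor>1 / y\<rfloor> + 1"
    have lo: "1 / y < of_int d" and hi: "of_int d - 1 \<le> 1 / y"
      unfolding d_def by linarith+
    have "1 < 1 / y" using Suc.prems by simp
    then have d2: "2 \<le> d" unfolding d_def by linarith
    then have dr: "2 \<le> real_of_int d" by simp
    define t where "t = y * of_int d - 1"
    have y: "y = (1 + t) / of_int d" using dr by (simp add: t_def)
    have t0: "0 < t" using lo Suc.prems by (simp add: t_def divide_simps mult.commute)
    have ty: "t \<le> y" using hi Suc.prems by (simp add: t_def field_simps)
    obtain x where x: "0 < x" "x < t" "t - x \<le> (1/2) ^ n" "engel_exponent x = \<alpha>"
      using Suc.IH[of t] t0 ty Suc.prems by auto
    have "y \<le> 1 / (of_int d - 1)" using hi dr Suc.prems by (simp add: field_simps)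
    then have "engel_map ((1 + x) / of_int d) = x"
      using d2 x ty by (intro engel_map_branch) auto
    moreover have "(1 + x) / of_int d \<noteq> 0" using dr x by auto
    ultimately have ex: "engel_exponent ((1 + x) / of_int d) = \<alpha>"
      using engel_exponent_engel_map x(4) by metis
    have "y - (1 + x) / of_int d = (t - x) / of_int d"
      by (simp add: y diff_divide_distrib[symmetric])
    also have "\<dots> \<le> (t - x) / 2"
      \<comment> \<open>The branch contracts by \<open>1 / d\<close>, and \<open>2 \<le> d\<close>
        supplies the factor that turns the bound for \<open>n\<close> into the one for
        \<open>Suc n\<close>.\<close>
      using dr x by (intro divide_left_mono) auto
    also have "\<dots> \<le> (1/2) ^ Suc n" using x by simp
    finally have "y - (1 + x) / of_int d \<le> (1/2) ^ Suc n" .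
    moreover have "(1 + x) / of_int d < y"
      using x dr by (simp add: y divide_strict_right_mono)
    moreover have "0 < (1 + x) / of_int d" using x dr by simp
    ultimately show ?case using ex by blast
  qed
  fix y :: real assume y: "y \<in> {0<..<1}"
  show "y \<in> closure {x \<in> {0<..<1}. engel_exponent x = \<alpha>}"
    unfolding closure_approachable
  proof (intro allI impI)
    fix e :: real assume "0 < e"
    then obtain n where n: "(1/2) ^ n < e"
      using real_arch_pow_inv[of e "1/2"] by auto
    obtain x where "0 < x" "x < y" "y - x \<le> (1/2) ^ n" "engel_exponent x = \<alpha>"
      using approx y by fastforce
    with n y show "\<exists>x\<in>{x \<in> {0<..<1}. engel_exponent x = \<alpha>}. dist x y < e"
      by (intro bexI[of _ x]) (auto simp: dist_real_def)
  qed
qed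

subsection \<open>Engel series with prescribed digits\<close>

definition engel_series :: "(nat \<Rightarrow> int) \<Rightarrow> real" where
  "engel_series a = (\<Sum>n. \<Prod>i\<le>n. 1 / of_int (a i))"

text \<open>The last condition rules out eventually constant sequences: a tail with constant value
  \<open>q\<close> sums to \<open>1 / (q - 1)\<close>, whose first digit is \<open>q - 1\<close>
  instead of \<open>q\<close>.\<close>

definition engel_admissible :: "(nat \<Rightarrow> int) \<Rightarrow> bool" where
  "engel_admissible a \<longleftrightarrow> mono a \<and> 2 \<le> a 0 \<and> (\<forall>n. \<exists>m. a n < a m)"

lemma engel_admissible_ge:
  assumes "engel_admissible a"
  shows "2 \<le> a n" "a 0 \<le> a n"
proof -
  show "a 0 \<le> a n" using assms by (auto simp: engel_admissible_def mono_def)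
  then show "2 \<le> a n" using assms by (auto simp: engel_admissible_def)
qed

lemma engel_admissible_shift:
  assumes "engel_admissible a"
  shows "engel_admissible (\<lambda>i. a (i + k))"
  unfolding engel_admissible_def
proof (intro conjI allI)
  have m: "mono a" using assms by (simp add: engel_admissible_def)
  show "mono (\<lambda>i. a (i + k))" using m by (auto simp: mono_def)
  show "2 \<le> a (0 + k)" using engel_admissible_ge[OF assms] by simp
  fix n
  obtain l where l: "a (n + k) < a l" using assms by (auto simp: engel_admissible_def)
  also have "a l \<le> a (l + k)" using m by (auto simp: mono_def)
  finally show "\<exists>l. a (n + k) < a (l + k)" by blast
qed

text \<open>The last factor is kept exact, so that a later strict increase of \<open>a\<close>
  yields a strict inequality in the comparison with a geometric series.\<close>

lemma prod_inverse_le_power: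
  assumes "engel_admissible a"
  shows "(\<Prod>i\<le>n. 1 / real_of_int (a i)) \<le> (1 / real_of_int (a 0)) ^ n * (1 / real_of_int (a n))"
proof -
  have pos: "0 < real_of_int (a i)" "real_of_int (a 0) \<le> real_of_int (a i)" for i
    using engel_admissible_ge[OF assms, of i] by auto
  have "(\<Prod>i<n. 1 / real_of_int (a i)) \<le> (\<Prod>i<n. 1 / real_of_int (a 0))"
    using pos by (intro prod_mono) (auto simp: frac_le less_imp_le)
  moreover have "0 \<le> 1 / real_of_int (a n)"
    using pos(1)[of n] by simp
  ultimately have "(\<Prod>i<n. 1 / real_of_int (a i)) * (1 / real_of_int (a n))
      \<le> (1 / real_of_int (a 0)) ^ n * (1 / real_of_int (a n))"
    by (intro mult_right_mono) auto
  then show ?thesis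
    by (simp add: lessThan_Suc_atMost[symmetric])
qed

lemma geometric_sums_inverse:
  fixes q :: real
  assumes "1 < q"
  shows "(\<lambda>n. (1 / q) ^ n * (1 / q)) sums (1 / (q - 1))"
proof -
  have "(\<lambda>n. (1 / q) ^ n * (1 / q)) sums (1 / (1 - 1 / q) * (1 / q))"
    using assms by (intro sums_mult2 geometric_sums) auto
  then show ?thesis using assms by (simp add: field_simps)
qed

text \<open>Comparison with the geometric series of ratio \<open>1 / a 0\<close>, whose sum is the
  upper bound. It is strict because some \<open>a m\<close> exceeds \<open>a 0\<close>.\<close>

lemma engel_series_basic:
  assumes "engel_admissible a"
  shows "summable (\<lambda>n. \<Prod>i\<le>n. 1 / real_of_int (a i))"
    and "0 < engel_series a" and "engel_series a < 1 / (of_int (a 0) - 1)"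
proof -
  let ?f = "\<lambda>n. \<Prod>i\<le>n. 1 / real_of_int (a i)"
  define q where "q = real_of_int (a 0)"
  have pos: "0 < real_of_int (a i)" "q \<le> real_of_int (a i)" "2 \<le> q" for i
    using engel_admissible_ge[OF assms, of i] engel_admissible_ge[OF assms, of 0]
    by (auto simp: q_def)
  have fpos: "0 < ?f n" for n using pos by (intro prod_pos) auto
  have f1: "?f n \<le> (1 / q) ^ n * (1 / real_of_int (a n))" for n
    unfolding q_def by (rule prod_inverse_le_power[OF assms])
  have f2: "(1 / q) ^ n * (1 / real_of_int (a n)) \<le> (1 / q) ^ n * (1 / q)" for n
    using pos by (intro mult_left_mono frac_le) auto
  have f: "?f n \<le> (1 / q) ^ n * (1 / q)" for n
    using f1 f2 by (rule order_trans)
  have geo: "(\<lambda>n. (1 / q) ^ n * (1 / q)) sums (1 / (q - 1))"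
    using pos(3) by (intro geometric_sums_inverse) auto
  show sum: "summable ?f"
    by (rule summable_comparison_test'[OF sums_summable[OF geo], of 0])
      (use f fpos in \<open>auto simp: less_imp_le\<close>)
  show "0 < engel_series a"
    unfolding engel_series_def by (intro suminf_pos sum fpos)
  obtain m where "a 0 < a m" using assms by (auto simp: engel_admissible_def)
  then have "q < real_of_int (a m)" by (simp add: q_def)
  then have "(1 / q) ^ m * (1 / real_of_int (a m)) < (1 / q) ^ m * (1 / q)"
    using pos(3) by (intro mult_strict_left_mono divide_strict_left_mono) auto
  then have strict: "?f m < (1 / q) ^ m * (1 / q)" using f1 by (rule le_less_trans[rotated])
  have "0 < (\<Sum>n. (1 / q) ^ n * (1 / q) - ?f n)"
    by (rule suminf_pos2[of _ m]) (use sum geo f strict in \<open>auto intro: summable_diff sums_summable\<close>)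
  also have "\<dots> = 1 / (q - 1) - engel_series a"
    unfolding engel_series_def
    using suminf_diff[OF sums_summable[OF geo] sum] sums_unique[OF geo] by simp
  finally show "engel_series a < 1 / (of_int (a 0) - 1)" by (simp add: q_def)
qed

lemma engel_series_rec:
  assumes "engel_admissible a"
  shows "engel_series a = (1 + engel_series (\<lambda>i. a (i + 1))) / of_int (a 0)"
proof -
  let ?f = "\<lambda>n. \<Prod>i\<le>n. 1 / real_of_int (a i)"
  let ?g = "\<lambda>n. \<Prod>i\<le>n. 1 / real_of_int (a (i + 1))"
  have f: "summable ?f" and g: "summable ?g"
    using engel_series_basic(1)[OF assms]
      engel_series_basic(1)[OF engel_admissible_shift[OF assms, of 1]] by simp_all
  have "?f (Suc n) = 1 / real_of_int (a 0) * ?g n" for n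
    by (subst prod.atMost_Suc_shift) simp
  then have "(\<Sum>n. ?f (Suc n)) = 1 / real_of_int (a 0) * engel_series (\<lambda>i. a (i + 1))"
    using g by (simp only: engel_series_def suminf_mult)
  then have "engel_series a = ?f 0 + 1 / real_of_int (a 0) * engel_series (\<lambda>i. a (i + 1))"
    using suminf_split_head[OF f] by (simp add: engel_series_def)
  then show ?thesis by (simp add: add_divide_distrib)
qed

text \<open>The tail is below \<open>1 / (a 1 - 1)\<close>, hence below \<open>1 / (a 0 - 1)\<close>
  by monotonicity, and so lies in the range of the inverse branch for the digit
  \<open>a 0\<close>.\<close>

lemma engel_series_step:
  assumes "engel_admissible a"
  shows "\<lceil>1 / engel_series a\<rceil> = a 0" "engel_map (engel_series a) = engel_series (\<lambda>i. a (i + 1))"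
proof -
  let ?t = "engel_series (\<lambda>i. a (i + 1))"
  note shift = engel_admissible_shift[OF assms, of 1]
  have a0: "2 \<le> a 0" "a 0 \<le> a 1"
    using engel_admissible_ge[OF assms, of 0] engel_admissible_ge[OF assms, of 1] by auto
  have "?t < 1 / (of_int (a 1) - 1)"
    using engel_series_basic(3)[OF shift] by simp
  also have "\<dots> \<le> 1 / (of_int (a 0) - 1)"
    using a0 by (intro frac_le) auto
  finally have t: "?t < 1 / (of_int (a 0) - 1)" .
  show "\<lceil>1 / engel_series a\<rceil> = a 0" "engel_map (engel_series a) = ?t"
    using engel_map_branch[OF a0(1) engel_series_basic(2)[OF shift] t]
    by (simp_all add: engel_series_rec[OF assms])
qed

lemma funpow_engel_map_series:
  assumes "engel_admissible a"
  shows "(engel_map ^^ n) (engel_series a) = engel_series (\<lambda>i. a (i + n))"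
proof (induction n)
  case (Suc n)
  have "engel_map (engel_series (\<lambda>i. a (i + n))) = engel_series (\<lambda>i. a (i + 1 + n))"
    by (rule engel_series_step(2)[OF engel_admissible_shift[OF assms]])
  then show ?case by (simp add: Suc.IH)
qed simp

lemma engel_series_digit:
  assumes "engel_admissible a"
  shows "\<lceil>1 / (engel_map ^^ n) (engel_series a)\<rceil> = a n" "(engel_map ^^ n) (engel_series a) \<noteq> 0"
proof -
  note shift = engel_admissible_shift[OF assms, of n]
  show "\<lceil>1 / (engel_map ^^ n) (engel_series a)\<rceil> = a n"
    using engel_series_step(1)[OF shift] by (simp add: funpow_engel_map_series[OF assms])
  show "(engel_map ^^ n) (engel_series a) \<noteq> 0"
    using engel_series_basic(2)[OF shift] by (simp add: funpow_engel_map_series[OF assms])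
qed

text \<open>The orbit never reaches 0, so the index set is all of the naturals, where unordered and
  ordinary summability agree for nonnegative terms.\<close>

lemma engel_exponent_series:
  assumes "engel_admissible a"
  shows "engel_exponent (engel_series a) =
    Inf (ereal ` {s. 0 \<le> s \<and> summable (\<lambda>n. real_of_int (a n) powr (- s))})"
  by (simp add: engel_exponent_def summable_on_engel_indices_iff engel_series_digit[OF assms]
      summable_on_UNIV_nonneg_real_iff)

subsection \<open>Growth rates realising every exponent\<close>

lemma Inf_ereal_image_eq:
  fixes r :: real
  assumes "{r<..} \<subseteq> S" "S \<subseteq> {r..}"
  shows "Inf (ereal ` S) = ereal r"
proof (rule antisym)
  show "ereal r \<le> Inf (ereal ` S)" using assms(2) by (auto intro!: INF_greatest)
  show "Inf (ereal ` S) \<le> ereal r"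
  proof (rule ereal_le_epsilon2)
    fix e :: real assume "0 < e"
    then have "r + e \<in> S" using assms(1) by auto
    then have "Inf (ereal ` S) \<le> ereal (r + e)" by (intro Inf_lower imageI)
    then show "Inf (ereal ` S) \<le> ereal r + ereal e" by simp
  qed
qed

lemma ex_sequence_with_exponent:
  fixes \<alpha> :: ereal
  assumes "0 \<le> \<alpha>"
  obtains g :: "nat \<Rightarrow> real" where "mono g" "\<And>n. 1 \<le> g n" "filterlim g at_top sequentially"
    "Inf (ereal ` {s. 0 \<le> s \<and> summable (\<lambda>n. g n powr (- s))}) = \<alpha>"
proof (cases \<alpha>)
  case (real r)
  then have "0 \<le> r" using assms by simp
  show ?thesis
  proof (cases "r = 0")
    case True
    let ?g = "\<lambda>n. 2 ^ n :: real"
    have "summable (\<lambda>n. ?g n powr (- s))" if "0 < s" for s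
    proof -
      have "?g n powr (- s) = (2 powr (- s)) ^ n" for n
        by (simp add: powr_realpow[symmetric] powr_powr mult.commute)
      moreover have "2 powr (- s) < (1 :: real)"
        using that by (simp add: powr_less_one)
      ultimately show ?thesis by simp
    qed
    then have "Inf (ereal ` {s. 0 \<le> s \<and> summable (\<lambda>n. ?g n powr (- s))}) = \<alpha>"
      unfolding real using True by (intro Inf_ereal_image_eq) auto
    moreover have "mono ?g" by (auto simp: mono_def)
    moreover have "filterlim ?g at_top sequentially" by real_asymp
    ultimately show ?thesis by (intro that[of ?g]) auto
  next
    case False
    then have r: "0 < r" using \<open>0 \<le> r\<close> by simp
    \<comment> \<open>With this exponent the series in question is the p-series for
      \<open>s / r\<close>, convergent exactly for \<open>r < s\<close>.\<close>
    let ?g = "\<lambda>n. real (Suc n) powr (1 / r)"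
    have "summable (\<lambda>n. ?g n powr (- s)) \<longleftrightarrow> r < s" for s
    proof -
      have "summable (\<lambda>n. ?g n powr (- s)) \<longleftrightarrow> summable (\<lambda>n. real n powr (- s / r))"
        by (subst (2) summable_Suc_iff[symmetric]) (simp add: powr_powr)
      also have "\<dots> \<longleftrightarrow> r < s"
        using r by (simp add: summable_real_powr_iff field_simps)
      finally show ?thesis .
    qed
    then have "{s. 0 \<le> s \<and> summable (\<lambda>n. ?g n powr (- s))} = {s. 0 \<le> s \<and> r < s}"
      by (simp only:)
    then have "Inf (ereal ` {s. 0 \<le> s \<and> summable (\<lambda>n. ?g n powr (- s))}) =
        Inf (ereal ` {s. 0 \<le> s \<and> r < s})"
      by (simp only:)
    also have "\<dots> = \<alpha>"
      unfolding real using r by (intro Inf_ereal_image_eq) auto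
    finally have "Inf (ereal ` {s. 0 \<le> s \<and> summable (\<lambda>n. ?g n powr (- s))}) = \<alpha>" .
    moreover have "mono ?g" using r by (auto simp: mono_def intro!: powr_mono2)
    moreover have "filterlim ?g at_top sequentially" using r by real_asymp
    moreover have "1 \<le> ?g n" for n using r by (intro ge_one_powr_ge_zero) auto
    ultimately show ?thesis by (intro that[of ?g]) auto
  qed
next
  case PInf
  \<comment> \<open>The shift by 3, which is at least \<open>exp 1\<close>, makes all values at
    least 1.\<close>
  let ?g = "\<lambda>n. ln (real n + 3)"
  have "\<not> summable (\<lambda>n. ?g n powr (- s))" for s
  proof
    assume "summable (\<lambda>n. ?g n powr (- s))"
    then have "summable (\<lambda>n. norm (?g n powr (- s)))" by simp
    \<comment> \<open>Every power of the logarithm grows more slowly than \<open>n\<close>, so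
      convergence would carry over to the harmonic series.\<close>
    moreover have "(\<lambda>n. real n powr (- 1)) \<in> O(\<lambda>n. ?g n powr (- s))"
      by (cases s "0 :: real" rule: linorder_cases) real_asymp+
    ultimately have "summable (\<lambda>n. real n powr (- 1))"
      by (rule summable_comparison_test_bigo)
    then show False
      by (simp only: summable_real_powr_iff)
  qed
  then have "Inf (ereal ` {s. 0 \<le> s \<and> summable (\<lambda>n. ?g n powr (- s))}) = \<alpha>"
    by (simp only: PInf simp_thms empty_def[symmetric] image_empty Inf_empty top_ereal_def)
  moreover have "mono ?g" by (auto simp: mono_def)
  moreover have "filterlim ?g at_top sequentially" by real_asymp
  moreover have "1 \<le> ?g n" for n
  proof -
    have "exp 1 \<le> real n + 3" using exp_le by linarith
    then show ?thesis by (simp add: ln_ge_iff)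
  qed
  ultimately show ?thesis by (intro that[of ?g]) auto
qed (use assms in auto)

text \<open>A ratio between 1 and \<open>c\<close> changes each term by a factor of at most
  \<open>c powr s\<close>.\<close>

lemma summable_powr_cong_bound:
  fixes f g :: "nat \<Rightarrow> real"
  assumes "0 < c" "\<And>n. 0 < f n" "\<And>n. f n \<le> g n" "\<And>n. g n \<le> c * f n" "0 \<le> s"
  shows "summable (\<lambda>n. f n powr (- s)) \<longleftrightarrow> summable (\<lambda>n. g n powr (- s))"
proof
  assume "summable (\<lambda>n. f n powr (- s))"
  then show "summable (\<lambda>n. g n powr (- s))"
    by (rule summable_comparison_test'[of _ 0]) (use assms in \<open>auto intro!: powr_mono2'\<close>)
next
  have gpos: "0 < g n" for n using assms(2,3)[of n] by linarith
  assume "summable (\<lambda>n. g n powr (- s))"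
  then have sum: "summable (\<lambda>n. c powr s * g n powr (- s))" by (rule summable_mult)
  have "f n powr (- s) \<le> c powr s * g n powr (- s)" for n
  proof -
    have "f n powr (- s) \<le> (g n / c) powr (- s)"
      using assms(1,4,5) gpos[of n] by (intro powr_mono2') (auto simp: field_simps)
    also have "\<dots> = c powr s * g n powr (- s)"
      using assms(1) gpos[of n] by (simp add: powr_divide powr_minus field_simps)
    finally show ?thesis .
  qed
  then show "summable (\<lambda>n. f n powr (- s))"
    by (intro summable_comparison_test'[OF sum, of 0]) simp
qed

text \<open>Since \<open>1 \<le> c * g n\<close>, rounding up adds less than 1 and at most doubles
  the value.\<close>

lemma summable_powr_ceiling_iff:
  assumes "1 \<le> c" "\<And>n. 1 \<le> g n" "0 \<le> s"
  shows "summable (\<lambda>n. real_of_int \<lceil>c * g n\<rceil> powr (- s)) \<longleftrightarrow> summable (\<lambda>n. g n powr (- s))"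
proof -
  have "g n \<le> real_of_int \<lceil>c * g n\<rceil> \<and> real_of_int \<lceil>c * g n\<rceil> \<le> 2 * c * g n" for n
  proof -
    have "1 * g n \<le> c * g n" using assms(1) assms(2)[of n] by (intro mult_right_mono) auto
    then show ?thesis using assms(2)[of n] by linarith
  qed
  moreover have "0 < g n" for n using assms(2)[of n] by linarith
  ultimately show ?thesis
    using assms by (intro summable_powr_cong_bound[symmetric, of "2 * c"]) auto
qed

subsection \<open>Size of the level sets\<close>

lemma engel_admissible_ceiling:
  fixes c :: real
  assumes "2 \<le> c" "mono g" "\<And>n. 1 \<le> g n" "filterlim g at_top sequentially"
  shows "engel_admissible (\<lambda>n. \<lceil>c * g n\<rceil>)"
  unfolding engel_admissible_def
proof (intro conjI allI)
  show "mono (\<lambda>n. \<lceil>c * g n\<rceil>)"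
    using assms(1,2) by (auto simp: mono_def intro!: ceiling_mono mult_left_mono)
  have "2 * 1 \<le> c * g 0" using assms(1) assms(3)[of 0] by (intro mult_mono) auto
  then show "2 \<le> \<lceil>c * g 0\<rceil>" by linarith
  fix n
  have "filterlim (\<lambda>n. c * g n) at_top sequentially"
    using assms by (intro filterlim_tendsto_pos_mult_at_top[OF tendsto_const]) auto
  then have "eventually (\<lambda>m. real_of_int \<lceil>c * g n\<rceil> < c * g m) sequentially"
    by (simp add: filterlim_at_top_dense)
  then obtain m where "real_of_int \<lceil>c * g n\<rceil> < c * g m"
    using eventually_happens sequentially_bot by blast
  then show "\<exists>m. \<lceil>c * g n\<rceil> < \<lceil>c * g m\<rceil>" by (intro exI[of _ m]) (simp add: less_ceiling_iff)
qed

text \<open>Equal ceilings force a difference below 1, whereas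
  \<open>\<bar>c - d\<bar> * g n\<close> is unbounded for distinct \<open>c\<close> and
  \<open>d\<close>.\<close>

lemma ceiling_multiple_eqD:
  assumes "filterlim g at_top sequentially" "\<And>n :: nat. \<lceil>c * g n\<rceil> = \<lceil>d * g n\<rceil>"
  shows "c = (d :: real)"
proof (rule ccontr)
  assume "c \<noteq> d"
  then have "filterlim (\<lambda>n. \<bar>c - d\<bar> * g n) at_top sequentially"
    using assms(1) by (intro filterlim_tendsto_pos_mult_at_top[OF tendsto_const]) auto
  then have "eventually (\<lambda>n. 1 < \<bar>c - d\<bar> * g n) sequentially"
    by (simp add: filterlim_at_top_dense)
  moreover have "eventually (\<lambda>n. 0 < g n) sequentially"
    using assms(1) by (simp add: filterlim_at_top_dense)
  ultimately have "eventually (\<lambda>n. 1 < \<bar>c * g n - d * g n\<bar>) sequentially"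
    by eventually_elim (simp add: abs_mult left_diff_distrib[symmetric])
  then obtain n where "1 < \<bar>c * g n - d * g n\<bar>"
    using eventually_happens sequentially_bot by blast
  with assms(2)[of n] show False by linarith
qed

theorem theorem3p2:
  fixes \<alpha> :: ereal
  assumes "0 \<le> \<alpha>"
  shows "uncountable {x \<in> {0<..<1::real}. engel_exponent x = \<alpha>}
    \<and> {0<..<1} \<subseteq> closure {x \<in> {0<..<1::real}. engel_exponent x = \<alpha>}"
proof -
  let ?L = "{x \<in> {0<..<1::real}. engel_exponent x = \<alpha>}"
  obtain g where g: "mono g" "\<And>n. 1 \<le> g n" "filterlim g at_top sequentially"
    and exponent: "Inf (ereal ` {s. 0 \<le> s \<and> summable (\<lambda>n. g n powr (- s))}) = \<alpha>"
    using ex_sequence_with_exponent[OF assms] by blast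
  define X where "X c = engel_series (\<lambda>n. \<lceil>c * g n\<rceil>)" for c
  note adm = engel_admissible_ceiling[OF _ g]
  have X_exponent: "engel_exponent (X c) = \<alpha>" if "2 \<le> c" for c
  proof -
    have "{s. 0 \<le> s \<and> summable (\<lambda>n. real_of_int \<lceil>c * g n\<rceil> powr (- s))} =
        {s. 0 \<le> s \<and> summable (\<lambda>n. g n powr (- s))}"
      using summable_powr_ceiling_iff[of c g] that g(2) by auto
    then show ?thesis
      using exponent by (simp add: X_def engel_exponent_series[OF adm[OF that]])
  qed
  have X_pos: "0 < X c" if "2 \<le> c" for c
    unfolding X_def by (rule engel_series_basic(2)[OF adm[OF that]])
  have X_less: "X c < 1 / (c - 1)" if "2 \<le> c" for c
  proof -
    have "X c < 1 / (real_of_int \<lceil>c * g 0\<rceil> - 1)"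
      unfolding X_def by (rule engel_series_basic(3)[OF adm[OF that]])
    also have "c * 1 \<le> c * g 0" using that g(2)[of 0] by (intro mult_left_mono) auto
    then have "c \<le> real_of_int \<lceil>c * g 0\<rceil>" by linarith
    then have "1 / (real_of_int \<lceil>c * g 0\<rceil> - 1) \<le> 1 / (c - 1)"
      using that by (intro frac_le) auto
    finally show ?thesis .
  qed
  \<comment> \<open>The digits of \<open>X c\<close> recover the whole sequence of ceilings, and
    this sequence determines \<open>c\<close>. An interval of parameters thus gives uncountably many
    points.\<close>
  have "inj_on X {2..3}"
  proof (rule inj_onI)
    fix c d assume "c \<in> {2..3}" "d \<in> {2..3}" "X c = X d"
    then have "\<lceil>c * g n\<rceil> = \<lceil>d * g n\<rceil>" for n
      using engel_series_digit(1)[OF adm, of c n] engel_series_digit(1)[OF adm, of d n]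
      by (simp add: X_def)
    then show "c = d" by (rule ceiling_multiple_eqD[OF g(3)])
  qed
  moreover have "X ` {2..3} \<subseteq> ?L"
  proof
    fix x assume "x \<in> X ` {2..3}"
    then obtain c where c: "2 \<le> c" "x = X c" by auto
    then have "1 / (c - 1) \<le> 1" by simp
    then have "X c < 1" using X_less[OF c(1)] by (rule less_le_trans[rotated])
    then show "x \<in> ?L" using c X_exponent[of c] X_pos[of c] by simp
  qed
  moreover have "uncountable {2..3 :: real}" by (simp add: uncountable_closed_interval)
  ultimately have "uncountable ?L"
    using countable_image_inj_on countable_subset by blast
  moreover have "{0<..<1} \<subseteq> closure ?L"
  proof (rule engel_level_set_dense)
    fix e :: real assume "0 < e"
    \<comment> \<open>For this choice \<open>1 / (c - 1) = e / (e + 1)\<close>, which is below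
      \<open>e\<close>.\<close>
    define c where "c = 2 + 1 / e"
    have c: "2 \<le> c" "1 / (c - 1) < e"
      using \<open>0 < e\<close> by (auto simp: c_def divide_simps)
    then show "\<exists>x. 0 < x \<and> x < e \<and> engel_exponent x = \<alpha>"
      using X_pos[of c] X_less[of c] X_exponent[of c] by (intro exI[of _ "X c"]) auto
  qed
  ultimately show ?thesis ..
qed

end
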